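(* Let $e\ge 2$ be an integer, let $\gamma=(\gamma_1,\ldots,\gamma_{e-1})$ be a vector of positive integers with $1\le\gamma_1\le\ldots\le\gamma_{e-1}$, and let $B\ne\{0\}$ be a finite nonempty subset of $\mathbb{N}^{e-1}$ whose complement $C=\mathbb{N}^{e-1}\setminus B$ satisfies $C+\mathbb{N}^{e-1}\subseteq C$. Then $$w(\gamma,B)\ge\frac{1}{e-1}.$$
   Context: $\mathbb{N}=\{0,1,2,\ldots\}$, and $x\cdot\gamma$ is the dot product. Wilf ratio: put $\max(B\cdot\gamma):=\max\{b\cdot\gamma\mid b\in B\}$, $n_0:=\lfloor\max(B\cdot\gamma)\rfloor$, and for $n=0,\ldots,n_0$ $$h_n:=\#\{b\in B\mid \lfloor b\cdot\gamma\rfloor=n\},\qquad h_n':=\#\{b\in B\mid n_0-\lfloor\max(B\cdot\gamma)-b\cdot\gamma\rfloor=n\}.$$ Then $$w(\gamma,B):=\frac{n_0h_0'+(n_0-1)h_1'+\ldots+0\cdot h_{n_0}'}{0\cdot h_0+1\cdot h_1+\ldots+n_0h_{n_0}}.$$ *)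

theory Defs
  imports Complex_Main "HOL-Library.Function_Algebras" "HOL-Library.Set_Algebras"
begin

text \<open>
  The monoid of vectors of natural numbers of length \<open>d\<close>. A vector is a function with coordinates
  \<open>1, \<dots>, d\<close> that vanishes at all other indices, so that equality of functions is equality
  of vectors, and the pointwise addition and zero (\<^theory>\<open>HOL-Library.Function_Algebras\<close>) and
  the sum of two sets (\<^theory>\<open>HOL-Library.Set_Algebras\<close>) are the usual ones.
\<close>
definition nat_vecs :: "nat \<Rightarrow> (nat \<Rightarrow> nat) set" where
  "nat_vecs d = {x. \<forall>i. i \<notin> {1..d} \<longrightarrow> x i = 0}"

definition dot :: "nat \<Rightarrow> (nat \<Rightarrow> nat) \<Rightarrow> (nat \<Rightarrow> real) \<Rightarrow> real" where
  "dot d x \<gamma> = (\<Sum>i = 1..d. real (x i) * \<gamma> i)"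

definition max_dot :: "nat \<Rightarrow> (nat \<Rightarrow> real) \<Rightarrow> (nat \<Rightarrow> nat) set \<Rightarrow> real" where
  "max_dot d \<gamma> B = Max {dot d b \<gamma> |b. b \<in> B}"

definition wilf_n0 :: "nat \<Rightarrow> (nat \<Rightarrow> real) \<Rightarrow> (nat \<Rightarrow> nat) set \<Rightarrow> int" where
  "wilf_n0 d \<gamma> B = \<lfloor>max_dot d \<gamma> B\<rfloor>"

definition wilf_h :: "nat \<Rightarrow> (nat \<Rightarrow> real) \<Rightarrow> (nat \<Rightarrow> nat) set \<Rightarrow> int \<Rightarrow> nat" where
  "wilf_h d \<gamma> B n = card {b \<in> B. \<lfloor>dot d b \<gamma>\<rfloor> = n}"

definition wilf_h' :: "nat \<Rightarrow> (nat \<Rightarrow> real) \<Rightarrow> (nat \<Rightarrow> nat) set \<Rightarrow> int \<Rightarrow> nat" where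
  "wilf_h' d \<gamma> B n = card {b \<in> B. wilf_n0 d \<gamma> B - \<lfloor>max_dot d \<gamma> B - dot d b \<gamma>\<rfloor> = n}"

definition wilf_ratio :: "nat \<Rightarrow> (nat \<Rightarrow> real) \<Rightarrow> (nat \<Rightarrow> nat) set \<Rightarrow> real" where
  "wilf_ratio d \<gamma> B =
     (\<Sum>n = 0..wilf_n0 d \<gamma> B. real_of_int (wilf_n0 d \<gamma> B - n) * real (wilf_h' d \<gamma> B n)) /
     (\<Sum>n = 0..wilf_n0 d \<gamma> B. real_of_int n * real (wilf_h d \<gamma> B n))"

end

theory Submission
  imports Defs
begin

text \<open>
  Reflecting every line of a finite order ideal \<open>B\<close> in direction \<open>i\<close>, a point \<open>b\<close> with top
  coordinate \<open>L\<close> on its line goes to the point with \<open>i\<close>-th coordinate \<open>L - b\<^sub>i\<close>. Hence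
  \<open>\<Sum>b\<^sub>i = \<Sum>(L - b\<^sub>i)\<close>, and since \<open>b \<cdot> \<gamma> + (L - b\<^sub>i) \<gamma>\<^sub>i\<close> is the value at the top of the line,
  \<open>\<Sum>(b \<cdot> \<gamma> + b\<^sub>i \<gamma>\<^sub>i) \<le> card B * max\<close>. Adding these inequalities over the \<open>d\<close> directions gives
  \<open>(d + 1) * \<Sum>(b \<cdot> \<gamma>) \<le> d * card B * max\<close>, which for integral \<open>\<gamma>\<close> is the bound on the Wilf ratio.
\<close>

lemma dot_fun_upd:
  assumes "i \<in> {1..d}"
  shows "dot d (b(i := k)) \<gamma> = dot d b \<gamma> + (real k - real (b i)) * \<gamma> i"
proof -
  have "dot d x \<gamma> = real (x i) * \<gamma> i + (\<Sum>j\<in>{1..d} - {i}. real (x j) * \<gamma> j)" for x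
    unfolding dot_def using assms by (simp add: sum.remove)
  from this[of b] this[of "b(i := k)"] show ?thesis
    by (simp add: algebra_simps)
qed

text \<open>The complement absorbs addition: a point \<open>x\<close> below \<open>b\<close> but
  outside \<open>B\<close> would force \<open>b = x + (b - x)\<close> out of \<open>B\<close>
  too.\<close>

lemma nat_vecs_order_ideal:
  assumes "B \<subseteq> nat_vecs d" "nat_vecs d - B + nat_vecs d \<subseteq> nat_vecs d - B"
    and "b \<in> B" "x \<le> b"
  shows "x \<in> B"
proof (rule ccontr)
  assume "x \<notin> B"
  have le: "x i \<le> b i" for i
    using \<open>x \<le> b\<close> by (simp add: le_fun_def)
  have b: "b i = 0" if "i \<notin> {1..d}" for i
    using assms(1,3) that by (auto simp: nat_vecs_def)
  have "x i = 0" if "i \<notin> {1..d}" for i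
    using le[of i] b[OF that] by simp
  with b have "x \<in> nat_vecs d" "b - x \<in> nat_vecs d"
    unfolding nat_vecs_def by simp_all
  moreover have "b = x + (b - x)"
    using le by (auto simp: fun_eq_iff)
  ultimately have "b \<in> nat_vecs d - B + nat_vecs d"
    using \<open>x \<notin> B\<close> by (metis DiffI set_plus_intro)
  with assms(2,3) show False
    by blast
qed

lemma sum_coordinate_reflection:
  fixes B :: "(nat \<Rightarrow> nat) set" and i :: nat
  assumes fin: "finite B" and ideal: "\<forall>b\<in>B. {..b} \<subseteq> B"
  obtains L :: "(nat \<Rightarrow> nat) \<Rightarrow> nat"
  where "\<And>b. b \<in> B \<Longrightarrow> b(i := L b) \<in> B"
    and "(\<Sum>b\<in>B. real (b i)) = (\<Sum>b\<in>B. real (L b) - real (b i))"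
proof
  \<comment> \<open>\<open>K b\<close> collects the \<open>i\<close>-th coordinates of the points of
    \<open>B\<close> on the line through \<open>b\<close> in direction \<open>i\<close>. It ignores
    \<open>b i\<close>, so all points of a line share the same top \<open>L b\<close>; hence
    \<open>r\<close> preserves \<open>L\<close>.\<close>
  define K where "K b = {k. b(i := k) \<in> B}" for b
  define L where "L b = Max (K b)" for b
  define r where "r b = b(i := L b - b i)" for b
  have K_fin: "finite (K b)" for b
  proof (rule finite_subset)
    show "K b \<subseteq> (\<lambda>x. x i) ` B"
      unfolding K_def by (force intro: rev_image_eqI)
  qed (use fin in simp)
  have K_self: "b i \<in> K b" if "b \<in> B" for b
    using that by (simp add: K_def)
  show top: "b(i := L b) \<in> B" if "b \<in> B" for b
    using Max_in[OF K_fin] K_self[OF that] by (fastforce simp: L_def K_def)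
  have le: "b i \<le> L b" if "b \<in> B" for b
    unfolding L_def by (rule Max_ge[OF K_fin K_self[OF that]])
  have r_in: "r b \<in> B" if "b \<in> B" for b
  proof -
    have "r b \<le> b(i := L b)"
      by (simp add: r_def le_fun_def)
    with ideal top[OF that] show ?thesis
      by blast
  qed
  have L_r: "L (r b) = L b" for b
    by (simp add: L_def K_def r_def)
  \<comment> \<open>Since \<open>b i \<le> L b\<close>, the truncated subtraction in
    \<open>r\<close> is exact, which makes \<open>r\<close> an involution of
    \<open>B\<close>.\<close>
  have r_r: "r (r b) = b" if "b \<in> B" for b
    using le[OF that] unfolding r_def[of "r b"] L_r by (simp add: r_def fun_eq_iff)
  have "(\<Sum>b\<in>B. real (b i)) = (\<Sum>b\<in>B. real (r b i))"
    by (rule sum.reindex_bij_witness[of _ r r]) (auto simp: r_in r_r)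
  also have "\<dots> = (\<Sum>b\<in>B. real (L b) - real (b i))"
    by (intro sum.cong) (auto simp: r_def of_nat_diff le)
  finally show "(\<Sum>b\<in>B. real (b i)) = (\<Sum>b\<in>B. real (L b) - real (b i))" .
qed

lemma max_dot_eq: "max_dot d \<gamma> B = Max ((\<lambda>b. dot d b \<gamma>) ` B)"
  by (simp add: max_dot_def Setcompr_eq_image)

lemma dot_le_max_dot: "finite B \<Longrightarrow> b \<in> B \<Longrightarrow> dot d b \<gamma> \<le> max_dot d \<gamma> B"
  by (simp add: max_dot_eq)

lemma sum_dot_le_max_dot:
  fixes B :: "(nat \<Rightarrow> nat) set"
  assumes fin: "finite B" and ideal: "\<forall>b\<in>B. {..b} \<subseteq> B"
  shows "(real d + 1) * (\<Sum>b\<in>B. dot d b \<gamma>) \<le> real d * (real (card B) * max_dot d \<gamma> B)"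
proof -
  let ?S = "\<Sum>b\<in>B. dot d b \<gamma>" and ?M = "max_dot d \<gamma> B"
  have direction: "?S + (\<Sum>b\<in>B. real (b i) * \<gamma> i) \<le> real (card B) * ?M" if i: "i \<in> {1..d}" for i
  proof -
    obtain L where L: "\<And>b. b \<in> B \<Longrightarrow> b(i := L b) \<in> B"
      and refl: "(\<Sum>b\<in>B. real (b i)) = (\<Sum>b\<in>B. real (L b) - real (b i))"
      by (rule sum_coordinate_reflection[OF fin ideal, of i]) (rule that)
    have "?S + (\<Sum>b\<in>B. real (b i) * \<gamma> i) = (\<Sum>b\<in>B. dot d b \<gamma> + (real (L b) - real (b i)) * \<gamma> i)"
      by (simp only: sum.distrib refl flip: sum_distrib_right)
    also have "\<dots> = (\<Sum>b\<in>B. dot d (b(i := L b)) \<gamma>)"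
      by (simp add: dot_fun_upd[OF i])
    also have "\<dots> \<le> real (card B) * ?M"
      by (rule sum_bounded_above) (simp add: dot_le_max_dot fin L)
    finally show ?thesis .
  qed
  \<comment> \<open>Over all directions the coordinate terms reassemble into one more copy of
    \<open>?S\<close> besides the \<open>d\<close> copies, whence the factor
    \<open>real d + 1\<close>.\<close>
  have "(\<Sum>i=1..d. \<Sum>b\<in>B. real (b i) * \<gamma> i) = ?S"
    unfolding dot_def by (rule sum.swap)
  then have "(real d + 1) * ?S = (\<Sum>i=1..d. ?S + (\<Sum>b\<in>B. real (b i) * \<gamma> i))"
    by (simp add: sum.distrib algebra_simps)
  also have "\<dots> \<le> (\<Sum>i=1..d. real (card B) * ?M)"
    by (rule sum_mono) (rule direction)
  finally show ?thesis
    by simp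
qed

text \<open>Double counting: each \<open>a\<close> contributes \<open>g (f a)\<close> at exactly one
  level. This turns the weighted counts in the Wilf ratio into sums over points of
  \<open>B\<close>.\<close>

lemma sum_card_level_sets:
  fixes g :: "'b \<Rightarrow> real"
  assumes "finite A" "finite T" "f ` A \<subseteq> T"
  shows "(\<Sum>n\<in>T. g n * real (card {a \<in> A. f a = n})) = (\<Sum>a\<in>A. g (f a))"
proof -
  have "(\<Sum>n\<in>T. g n * real (card {a \<in> A. f a = n})) = (\<Sum>n\<in>T. \<Sum>a\<in>{a \<in> A. f a = n}. g (f a))"
    by (intro sum.cong) (auto simp: mult.commute)
  also have "\<dots> = (\<Sum>a\<in>A. g (f a))"
    by (rule sum.group[OF assms])
  finally show ?thesis .
qed

text \<open>For integral weights all dot products are integers, so the floors disappear and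
  \<open>wilf_h\<close> and \<open>wilf_h'\<close> count the same level sets.\<close>

lemma wilf_ratio_nat:
  fixes \<gamma> :: "nat \<Rightarrow> nat"
  assumes "finite B" "B \<noteq> {}"
  shows "wilf_ratio d (\<lambda>i. real (\<gamma> i)) B =
    (\<Sum>b\<in>B. max_dot d (\<lambda>i. real (\<gamma> i)) B - dot d b (\<lambda>i. real (\<gamma> i))) /
    (\<Sum>b\<in>B. dot d b (\<lambda>i. real (\<gamma> i)))"
proof -
  define N where "N b = int (\<Sum>i=1..d. b i * \<gamma> i)" for b
  define M where "M = wilf_n0 d (\<lambda>i. real (\<gamma> i)) B"
  have dot: "dot d b (\<lambda>i. real (\<gamma> i)) = of_int (N b)" for b
    by (simp add: dot_def N_def)
  \<comment> \<open>The maximum is attained on \<open>B\<close>, so it is an integer and equals its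
    floor \<open>M\<close>.\<close>
  have "max_dot d (\<lambda>i. real (\<gamma> i)) B \<in> (\<lambda>b. of_int (N b)) ` B"
    unfolding max_dot_eq dot using assms by (intro Max_in) auto
  then have max: "max_dot d (\<lambda>i. real (\<gamma> i)) B = of_int M"
    unfolding M_def wilf_n0_def by auto
  have "N b \<le> M" if "b \<in> B" for b
    using dot_le_max_dot[OF assms(1) that, of d "\<lambda>i. real (\<gamma> i)"] by (simp add: dot max)
  moreover have "0 \<le> N b" for b
    unfolding N_def by (rule of_nat_0_le_iff)
  ultimately have range: "N ` B \<subseteq> {0..M}"
    by auto
  have h: "wilf_h d (\<lambda>i. real (\<gamma> i)) B n = card {b \<in> B. N b = n}" for n
    by (simp add: wilf_h_def dot)
  have h': "wilf_h' d (\<lambda>i. real (\<gamma> i)) B n = card {b \<in> B. N b = n}" for n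
    by (simp add: wilf_h'_def dot max flip: M_def of_int_diff)
  show ?thesis
    unfolding wilf_ratio_def h h' dot max M_def[symmetric]
    using sum_card_level_sets[OF assms(1) _ range, of "\<lambda>n. real_of_int (M - n)"]
      sum_card_level_sets[OF assms(1) _ range, of real_of_int]
    by simp
qed

theorem mainTheorem3:
  fixes e :: nat and \<gamma> :: "nat \<Rightarrow> nat" and B C :: "(nat \<Rightarrow> nat) set"
  assumes "e \<ge> 2"
    and "\<forall>i\<in>{1..e - 1}. 1 \<le> \<gamma> i"
    and "mono_on {1..e - 1} \<gamma>"
    and "B \<subseteq> nat_vecs (e - 1)"
    and "finite B"
    and "B \<noteq> {}"
    and "B \<noteq> {0}"
    and "C = nat_vecs (e - 1) - B"
    and "C + nat_vecs (e - 1) \<subseteq> C"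
  shows "wilf_ratio (e - 1) (\<lambda>i. real (\<gamma> i)) B \<ge> 1 / (real e - 1)"
proof -
  define d where "d = e - 1"
  have d: "d \<ge> 1" "real e - 1 = real d"
    using assms(1) by (auto simp: d_def)
  let ?dot = "\<lambda>b. dot d b (\<lambda>i. real (\<gamma> i))" and ?M = "max_dot d (\<lambda>i. real (\<gamma> i)) B"
  have ideal: "\<forall>b\<in>B. {..b} \<subseteq> B"
    using nat_vecs_order_ideal[of B "e - 1"] assms(4,8,9) by auto
  have bound: "(real d + 1) * sum ?dot B \<le> real d * (real (card B) * ?M)"
    by (rule sum_dot_le_max_dot[OF assms(5) ideal])
  \<comment> \<open>The denominator has to be positive, as division by zero would give the ratio 0.
    A nonzero \<open>b\<close> has a nonzero coordinate, necessarily in \<open>{1..d}\<close>, where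
    the weight is at least 1.\<close>
  obtain b where b: "b \<in> B" "b \<noteq> 0"
    using assms(6,7) by blast
  then obtain i where "b i \<noteq> 0"
    by (auto simp: fun_eq_iff)
  moreover have "b \<in> nat_vecs d"
    using assms(4) b(1) unfolding d_def by (rule subsetD)
  then have "b i = 0" if "i \<notin> {1..d}"
    using that by (simp add: nat_vecs_def)
  ultimately have i: "i \<in> {1..d}"
    by metis
  then have "1 \<le> \<gamma> i"
    using assms(2) unfolding d_def by blast
  with \<open>b i \<noteq> 0\<close> have "0 < real (b i) * real (\<gamma> i)"
    by simp
  then have "0 < ?dot b"
    unfolding dot_def by (intro sum_pos2[OF _ i]) auto
  then have "0 < sum ?dot B"
    by (intro sum_pos2[OF assms(5) b(1)]) (auto simp: dot_def intro: sum_nonneg)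
  \<comment> \<open>With \<open>S = sum ?dot B\<close>, the bound rearranges to
    \<open>S \<le> d * (card B * ?M - S)\<close>; then divide by \<open>d * S\<close>.\<close>
  then have "1 / real d \<le> (\<Sum>b\<in>B. ?M - ?dot b) / sum ?dot B"
    using bound d(1) by (simp add: sum_subtractf field_simps)
  then show ?thesis
    by (simp only: wilf_ratio_nat[OF assms(5,6)] d(2) flip: d_def)
qed

end
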